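(* Suppose that $A\sim\mathrm{SBiSBM}(Z_1,Z_2,p,q)$ with $K=L=2$, $n_2\gg n_1\log n_1$, $n_1n_2p_{\max}^2\to\infty$ and $n_1n_2p_{\max}^2=O(\log n_1)$ as $n_1\to\infty$, where $p_{\max}=p$ and $q=cp$ for a constant $c\in(0,1)$. Then there exists a constant $c_1>0$ such that, for all $n_1$ large enough, $$\inf_{\hat z}\sup_{\theta\in\Theta}\mathbb E\big(r(\hat z,z)\big)\ge\exp(-c_1n_1n_2p_{\max}^2),$$ where the infimum is taken over all measurable functions $\hat z$ of $A$. Moreover, if (in place of the two growth conditions on $n_1n_2p_{\max}^2$) $n_1n_2p_{\max}^2=\Theta(1)$, then $\inf_{\hat z}\sup_{\theta\in\Theta}\mathbb E(r(\hat z,z))\ge c_2$ for some positive constant $c_2$.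
   Context: There are $n_1$ row nodes and $n_2$ column nodes, each partitioned into $K$ communities, with membership matrices $Z_1\in\mathcal M_{n_1,K}$, $Z_2\in\mathcal M_{n_2,K}$, where $\mathcal M_{n,K}$ is the set of $n\times K$ $0/1$ matrices with exactly one 1 in each row. $z:[n_1]\to[K]$ is the partition function of $Z_1$ ($z_i=k$ iff $(Z_1)_{ik}=1$). $A\sim\mathrm{SBiSBM}(Z_1,Z_2,p,q)$ means that $A\in\{0,1\}^{n_1\times n_2}$ has independent entries $A_{ij}\sim\mathrm{Bernoulli}(P_{ij})$ with $P=Z_1\Pi Z_2^\top$ and $\Pi=(p-q)I_K+q\mathbf 1_K\mathbf 1_K^\top$, $1\ge p>q\ge0$. The parameter space $\Theta$ is the set of matrices $P=Z_1\Pi Z_2^\top\in[0,1]^{n_1\times n_2}$ with $\Pi=q\mathbf 1_K\mathbf 1_K^\top+(p-q)I_K$, $0<p<1$, $q=cp$ for a constant $c\in(0,1)$, and $Z_1\in\mathcal M_{n_1,K}$, $Z_2\in\mathcal M_{n_2,K}$ such that the row communities $\mathcal C_k$ and column communities $\mathcal C'_l$ satisfy $\frac{n_1}{\alpha K}\le|\mathcal C_k|\le\frac{\alpha n_1}{K}$ and $\frac{n_2}{\alpha K}\le|\mathcal C'_l|\le\frac{\alpha n_2}{K}$ for all $k,l\in[K]$ with $\alpha=1+O(\sqrt{\log n_1/n_1})$. Here $p$ (hence $q$) is the given sequence of edge probabilities, so the supremum is over $(Z_1,Z_2)$. Misclustering rate: $r(\hat z,z)=\frac1{n_1}\min_\pi\sum_{i\in[n_1]}\mathbf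 1_{\{\hat z(i)\ne\pi(z(i))\}}$, minimum over permutations $\pi$ of $[K]$. Notation: $a_n\gg b_n$ means $a_n/b_n\to\infty$; $a_n=O(b_n)$ means $a_n\le Cb_n$ for some constant $C>0$ and $n$ large enough; $a_n=\Theta(b_n)$ means $a_n=O(b_n)$ and $b_n=O(a_n)$. In the paper's notation, $c_1,c_2,\dots$ denote universal constants. *)

theory Defs
  imports
    "HOL-Probability.Probability"
    "HOL-Library.Landau_Symbols"
    "HOL-Combinatorics.Permutations"
    "Jordan_Normal_Form.Matrix"
begin

text \<open>Nodes and communities are numbered from 0: \<open>[n]\<close> is \<^term>\<open>{..<n::nat}\<close>.\<close>

definition membership_mats :: "nat \<Rightarrow> nat \<Rightarrow> real mat set" where
  "membership_mats n K =
     {Z \<in> carrier_mat n K.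
        (\<forall>i<n. \<forall>k<K. Z $$ (i, k) \<in> {0, 1}) \<and> (\<forall>i<n. \<exists>!k. k < K \<and> Z $$ (i, k) = 1)}"

definition partition_fun :: "real mat \<Rightarrow> nat \<Rightarrow> nat" where
  "partition_fun Z i = (THE k. k < dim_col Z \<and> Z $$ (i, k) = 1)"

definition community :: "real mat \<Rightarrow> nat \<Rightarrow> nat set" where
  "community Z k = {i. i < dim_row Z \<and> partition_fun Z i = k}"

definition connectivity :: "nat \<Rightarrow> real \<Rightarrow> real \<Rightarrow> real mat" where
  "connectivity K p q = (p - q) \<cdot>\<^sub>m 1\<^sub>m K + q \<cdot>\<^sub>m mat K K (\<lambda>_. 1)"

definition edge_probs :: "real mat \<Rightarrow> real mat \<Rightarrow> real \<Rightarrow> real \<Rightarrow> real mat" where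
  "edge_probs Z1 Z2 p q = Z1 * connectivity (dim_col Z1) p q * transpose_mat Z2"

text \<open>The law of the adjacency matrix. The default value \<^term>\<open>False\<close> of \<^const>\<open>Pi_pmf\<close> only
  concerns indices outside the matrix.\<close>

definition SBiSBM :: "real mat \<Rightarrow> real mat \<Rightarrow> real \<Rightarrow> real \<Rightarrow> real mat pmf" where
  "SBiSBM Z1 Z2 p q =
     map_pmf (\<lambda>e. mat (dim_row Z1) (dim_row Z2) (\<lambda>ij. of_bool (e ij)))
       (Pi_pmf ({..<dim_row Z1} \<times> {..<dim_row Z2}) False
          (\<lambda>ij. bernoulli_pmf (edge_probs Z1 Z2 p q $$ ij)))"

text \<open>Since \<open>p\<close> and \<open>q\<close> are given, a parameter is determined by its pair of membership matrices.\<close>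

definition param_space :: "nat \<Rightarrow> nat \<Rightarrow> nat \<Rightarrow> real \<Rightarrow> (real mat \<times> real mat) set" where
  "param_space n1 n2 K \<alpha> =
     {(Z1, Z2). Z1 \<in> membership_mats n1 K \<and> Z2 \<in> membership_mats n2 K \<and>
        (\<forall>k<K. real n1 / (\<alpha> * real K) \<le> real (card (community Z1 k)) \<and>
               real (card (community Z1 k)) \<le> \<alpha> * real n1 / real K) \<and>
        (\<forall>l<K. real n2 / (\<alpha> * real K) \<le> real (card (community Z2 l)) \<and>
               real (card (community Z2 l)) \<le> \<alpha> * real n2 / real K)}"

definition misclustering :: "nat \<Rightarrow> nat \<Rightarrow> (nat \<Rightarrow> nat) \<Rightarrow> (nat \<Rightarrow> nat) \<Rightarrow> real" where
  "misclustering n1 K zh z =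
     (1 / real n1) * (MIN \<pi>\<in>{\<pi>. \<pi> permutes {..<K}}. \<Sum>i<n1. of_bool (zh i \<noteq> \<pi> (z i)))"

text \<open>The sample space is discrete, so every function of the adjacency matrix is measurable.\<close>

definition estimators :: "nat \<Rightarrow> nat \<Rightarrow> (real mat \<Rightarrow> nat \<Rightarrow> nat) set" where
  "estimators n1 K = {zh. \<forall>A. \<forall>i<n1. zh A i < K}"

text \<open>All risks lie in the unit interval, so the real-valued infimum and supremum are the genuine
  ones as soon as the parameter space is nonempty and \<open>K > 0\<close>.\<close>

definition minimax_risk :: "nat \<Rightarrow> nat \<Rightarrow> nat \<Rightarrow> real \<Rightarrow> real \<Rightarrow> real \<Rightarrow> real" where
  "minimax_risk n1 n2 K p q \<alpha> =
     (INF zh\<in>estimators n1 K. SUP (Z1, Z2)\<in>param_space n1 n2 K \<alpha>.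
        measure_pmf.expectation (SBiSBM Z1 Z2 p q)
          (\<lambda>A. misclustering n1 K (zh A) (partition_fun Z1)))"

text \<open>The number \<open>n\<close> of row nodes is the asymptotic parameter; \<open>n2\<close>, \<open>p\<close> and \<open>\<alpha>\<close> are sequences
  indexed by it, while \<open>c\<close> is constant. The last conjunct excludes sequences such as \<open>\<alpha> n < 1\<close>, or
  \<open>\<alpha> n = 1\<close> with \<open>n\<close> odd, for which the supremum would range over the empty set.\<close>

definition two_community_regime ::
    "real \<Rightarrow> (nat \<Rightarrow> nat) \<Rightarrow> (nat \<Rightarrow> real) \<Rightarrow> (nat \<Rightarrow> real) \<Rightarrow> bool" where
  "two_community_regime c n2 p \<alpha> \<longleftrightarrow>
     0 < c \<and> c < 1 \<and> (\<forall>n. 0 < p n \<and> p n < 1) \<and>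
     filterlim (\<lambda>n. real (n2 n) / (real n * ln (real n))) at_top sequentially \<and>
     (\<lambda>n. \<alpha> n - 1) \<in> O(\<lambda>n. sqrt (ln (real n) / real n)) \<and>
     (\<forall>\<^sub>F n in sequentially. param_space n (n2 n) 2 (\<alpha> n) \<noteq> {})"

end

theory Submission
  imports Defs
begin

text \<open>Write \<open>n\<close> and \<open>m\<close> for the numbers of rows and columns, and \<open>\<lambda> = n m p\<^sup>2\<close>. Information about the rows
  comes only from columns that meet several of them: since the column labels are unknown, a column
  that meets one row does not tell the label of this row. A given row shares a column with some
  other row about \<open>\<lambda>\<close> times, so with probability about \<open>exp (- \<lambda>)\<close>, up to a constant in the
  exponent, it shares none, and then its label can only be guessed. A constant proportion of such
  guesses fails, hence the bound.

  To make this precise when the communities may be forced to be exactly balanced, the rows and the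
  columns are grouped into pairs of opposite labels, and the prior is uniform over all orientations
  of the pairs (\<open>transversals\<close>). These labellings belong to the parameter space whenever it is
  nonempty (\<open>label_mats_in_param_space\<close>). A row pair is \<open>isolated\<close> in a matrix if no column pair
  meets both this row pair and another row, and the row pair avoids an unpaired last column. Then
  reversing the row pair together with the column pairs that it meets leaves the likelihood exactly
  unchanged (\<open>pmf_edge_law_flip\<close>). Hence, whatever the estimator, the relation of a row of this pair
  to a row outside it is misjudged with posterior probability one half (\<open>posterior_pair_error\<close>).
  Half the proportion of misjudged pairs of rows is a lower bound of the misclustering rate, for every
  matching of the communities (\<open>misclustering_ge_pairs\<close>), so the minimax risk is at least a constant
  times the least probability of isolation (\<open>minimax_risk_ge\<close>).

  The column pairs are independent, and each spoils isolation with probability at most \<open>8 n p\<^sup>2\<close>, by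
  a union bound over pairs of edges. As \<open>n p\<^sup>2\<close> tends to 0 in the regime considered, isolation has
  probability at least \<open>exp (- 8 \<lambda>) / 2\<close> (\<open>prob_isolated_ge\<close>). Both claims follow: if \<open>\<lambda>\<close> tends to
  infinity, the constant factors are absorbed by a slightly larger exponent, and if \<open>\<lambda>\<close> is bounded,
  the bound itself is a positive constant.\<close>

section \<open>Pairs of nodes and balanced labellings\<close>

text \<open>The involution that exchanges \<open>2s\<close> and \<open>2s + 1\<close>.\<close>
definition mate :: "nat \<Rightarrow> nat" where
  "mate i = (if even i then Suc i else i - 1)"

text \<open>If \<open>n\<close> is odd, the last node \<open>n - 1\<close> has no partner and is left out.\<close>
definition paired :: "nat \<Rightarrow> nat set" where
  "paired n = {..<2 * (n div 2)}"

lemma mate_mate [simp]: "mate (mate i) = i"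
  by (auto simp: mate_def elim: oddE)

lemma mate_neq [simp]: "mate i \<noteq> i" "i \<noteq> mate i"
  by (auto simp: mate_def elim: oddE)

lemma mate_eq_iff: "mate i = j \<longleftrightarrow> i = mate j"
  by auto

lemma mate_paired_iff [simp]: "mate i \<in> paired n \<longleftrightarrow> i \<in> paired n"
  by (auto simp: mate_def paired_def elim!: evenE oddE)

lemma finite_paired [simp]: "finite (paired n)"
  by (simp add: paired_def)

lemma paired_less: "i \<in> paired n \<Longrightarrow> i < n"
  by (auto simp: paired_def)

lemma mate_less: "i \<in> paired n \<Longrightarrow> mate i < n"
  using paired_less[of "mate i"] by simp

text \<open>A labelling by two communities is represented by the set of nodes with label 1. In a transversal the
  two nodes of every pair have opposite labels, and an unpaired last node has label 0. These
  labellings are as balanced as the parity of \<open>n\<close> permits, and they stay so when the labels of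
  some pairs are exchanged.\<close>
definition transversals :: "nat \<Rightarrow> nat set set" where
  "transversals n = {Z. Z \<subseteq> paired n \<and> (\<forall>i\<in>paired n. mate i \<in> Z \<longleftrightarrow> i \<notin> Z)}"

lemma finite_transversals [simp]: "finite (transversals n)"
  by (rule finite_subset[of _ "Pow (paired n)"]) (auto simp: transversals_def)

lemma transversals_nonempty: "transversals n \<noteq> {}"
proof -
  have "{i \<in> paired n. even i} \<in> transversals n"
    by (auto simp: transversals_def) (auto simp: mate_def split: if_splits)
  thus ?thesis by blast
qed

lemma card_transversal:
  assumes "Z \<in> transversals n"
  shows "card Z = n div 2"
proof -
  have Z: "Z \<subseteq> paired n" "\<And>i. i \<in> paired n \<Longrightarrow> mate i \<in> Z \<longleftrightarrow> i \<notin> Z"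
    using assms by (auto simp: transversals_def)
  have "bij_betw mate Z (paired n - Z)"
    by (rule bij_betw_byWitness[where f' = mate]) (use Z in auto)
  hence "card Z = card (paired n - Z)"
    by (rule bij_betw_same_card)
  also have "\<dots> = card (paired n) - card Z"
    using Z by (intro card_Diff_subset) (auto intro: finite_subset)
  finally show ?thesis
    using card_mono[OF finite_paired Z(1)] by (simp add: paired_def)
qed

definition flip :: "nat set \<Rightarrow> nat set \<Rightarrow> nat set" where
  "flip S Z = (Z - S) \<union> (S - Z)"

lemma mem_flip_iff: "i \<in> flip S Z \<longleftrightarrow> (i \<in> Z \<longleftrightarrow> i \<notin> S)"
  by (auto simp: flip_def)

lemma flip_flip [simp]: "flip S (flip S Z) = Z"
  by (auto simp: flip_def)

lemma flip_transversal:
  assumes "Z \<in> transversals n" "S \<subseteq> paired n" "\<And>i. i \<in> S \<Longrightarrow> mate i \<in> S"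
  shows "flip S Z \<in> transversals n"
proof -
  have "mate i \<in> S \<longleftrightarrow> i \<in> S" for i
    using assms(3)[of i] assms(3)[of "mate i"] by auto
  thus ?thesis
    using assms(1,2) by (auto simp: transversals_def mem_flip_iff)
qed

lemma bij_betw_flip_transversals:
  assumes "S \<subseteq> paired n" "\<And>i. i \<in> S \<Longrightarrow> mate i \<in> S"
  shows "bij_betw (flip S) (transversals n) (transversals n)"
  by (rule bij_betw_byWitness[where f' = "flip S"]) (use assms in \<open>auto intro!: flip_transversal\<close>)

section \<open>Membership matrices of labellings\<close>

definition label_mat :: "nat \<Rightarrow> nat set \<Rightarrow> real mat" where
  "label_mat n Z = mat n 2 (\<lambda>(i, k). of_bool (k = of_bool (i \<in> Z)))"

lemma dim_label_mat [simp]: "dim_row (label_mat n Z) = n" "dim_col (label_mat n Z) = 2"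
  by (simp_all add: label_mat_def)

lemma label_mat_membership: "label_mat n Z \<in> membership_mats n 2"
proof -
  have "\<exists>!k. k < 2 \<and> label_mat n Z $$ (i, k) = 1" if "i < n" for i
    by (rule ex1I[of _ "of_bool (i \<in> Z)"]) (use that in \<open>auto simp: label_mat_def split: if_splits\<close>)
  thus ?thesis
    by (auto simp: membership_mats_def) (auto simp: label_mat_def)
qed

lemma partition_fun_label_mat:
  assumes "i < n"
  shows "partition_fun (label_mat n Z) i = of_bool (i \<in> Z)"
  unfolding partition_fun_def
  by (rule the_equality) (use assms in \<open>auto simp: label_mat_def split: if_splits\<close>)

lemma card_community_label_mat:
  assumes "Z \<in> transversals n" "k < 2"
  shows "card (community (label_mat n Z) k) \<in> {n div 2, n - n div 2}"
proof -
  have Z: "Z \<subseteq> {..<n}"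
    using assms(1) by (auto simp: transversals_def dest: paired_less)
  have "community (label_mat n Z) k = {i. i < n \<and> of_bool (i \<in> Z) = k}"
    using partition_fun_label_mat by (auto simp: community_def)
  also have "\<dots> = (if k = 1 then Z else {..<n} - Z)"
    using assms(2) Z by (cases "k = 1") (auto split: if_splits)
  finally show ?thesis
    using card_transversal[OF assms(1)] card_Diff_subset[of Z "{..<n}"] finite_subset[OF Z] Z
    by simp
qed

lemma partition_fun_less:
  assumes "Z \<in> membership_mats n K" "i < n"
  shows "partition_fun Z i < K"
proof -
  have "\<exists>!k. k < K \<and> Z $$ (i, k) = 1" and "dim_col Z = K"
    using assms by (auto simp: membership_mats_def)
  thus ?thesis
    unfolding partition_fun_def by (metis (mono_tags, lifting) theI')
qed

lemma card_two_communities: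
  assumes "Z \<in> membership_mats n 2"
  shows "card (community Z 0) + card (community Z 1) = n"
proof -
  have dim: "dim_row Z = n"
    using assms by (auto simp: membership_mats_def)
  have "community Z 0 \<union> community Z 1 = {..<n}"
    using partition_fun_less[OF assms] by (auto simp: community_def dim less_2_cases_iff)
  moreover have "community Z 0 \<inter> community Z 1 = {}" "finite (community Z k)" for k
    by (auto simp: community_def)
  ultimately show ?thesis
    by (metis card_Un_disjoint card_lessThan)
qed

text \<open>A division of \<open>n\<close> into the most equal parts lies between the parts of any other division. This is
  why every transversal meets the size constraints as soon as some labelling does.\<close>
lemma halves_between:
  fixes a b n :: nat
  assumes "a + b = n" "x \<in> {n div 2, n - n div 2}"
  shows "min a b \<le> x \<and> x \<le> max a b"
  using assms by auto

lemma balanced_sizes_feasible: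
  assumes "Z0 \<in> membership_mats n 2" "Z \<in> transversals n" "k < 2"
    and "\<forall>k<2. l \<le> real (card (community Z0 k)) \<and> real (card (community Z0 k)) \<le> r"
  shows "l \<le> real (card (community (label_mat n Z) k)) \<and> real (card (community (label_mat n Z) k)) \<le> r"
proof -
  let ?a = "card (community Z0 0)" and ?b = "card (community Z0 1)"
  have "min ?a ?b \<le> card (community (label_mat n Z) k)" "card (community (label_mat n Z) k) \<le> max ?a ?b"
    using halves_between[OF card_two_communities[OF assms(1)] card_community_label_mat[OF assms(2,3)]]
    by auto
  moreover have "l \<le> real ?a" "real ?a \<le> r" "l \<le> real ?b" "real ?b \<le> r"
    using assms(4) by auto
  ultimately show ?thesis
    by (auto simp: min_def max_def split: if_splits)
qed

lemma label_mats_in_param_space: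
  assumes "param_space n m 2 \<alpha> \<noteq> {}" "Z \<in> transversals n" "W \<in> transversals m"
  shows "(label_mat n Z, label_mat m W) \<in> param_space n m 2 \<alpha>"
proof -
  obtain \<theta> where "\<theta> \<in> param_space n m 2 \<alpha>"
    using assms(1) by blast
  moreover obtain Z0 W0 where "\<theta> = (Z0, W0)"
    by (cases \<theta>)
  ultimately have "(Z0, W0) \<in> param_space n m 2 \<alpha>"
    by simp
  note \<theta> = this[unfolded param_space_def mem_Collect_eq prod.case]
  note mem = \<theta>[THEN conjunct1] \<theta>[THEN conjunct2, THEN conjunct1]
    and sizes = \<theta>[THEN conjunct2, THEN conjunct2, THEN conjunct1]
      \<theta>[THEN conjunct2, THEN conjunct2, THEN conjunct2]
  show ?thesis
    unfolding param_space_def mem_Collect_eq prod.case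
    by (intro conjI label_mat_membership allI impI)
       (rule balanced_sizes_feasible[OF mem(1) assms(2) _ sizes(1), THEN conjunct1]
             balanced_sizes_feasible[OF mem(1) assms(2) _ sizes(1), THEN conjunct2]
             balanced_sizes_feasible[OF mem(2) assms(3) _ sizes(2), THEN conjunct1]
             balanced_sizes_feasible[OF mem(2) assms(3) _ sizes(2), THEN conjunct2]; assumption)+
qed

section \<open>The law of the matrix\<close>

definition edge_law ::
    "nat \<Rightarrow> nat \<Rightarrow> real \<Rightarrow> real \<Rightarrow> nat set \<Rightarrow> nat set \<Rightarrow> (nat \<times> nat \<Rightarrow> bool) pmf" where
  "edge_law n m p q Z W = Pi_pmf ({..<n} \<times> {..<m}) False
     (\<lambda>(i, j). bernoulli_pmf (if i \<in> Z \<longleftrightarrow> j \<in> W then p else q))"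

lemma edge_probs_label_mat:
  assumes "i < n" "j < m"
  shows "edge_probs (label_mat n Z) (label_mat m W) p q $$ (i, j) =
           (if i \<in> Z \<longleftrightarrow> j \<in> W then p else q)"
  using assms
  by (auto simp: edge_probs_def connectivity_def label_mat_def scalar_prod_def numeral_2_eq_2)

lemma SBiSBM_label_mat:
  "SBiSBM (label_mat n Z) (label_mat m W) p q =
     map_pmf (\<lambda>e. mat n m (\<lambda>ij. of_bool (e ij))) (edge_law n m p q Z W)"
  unfolding SBiSBM_def edge_law_def
  by (intro arg_cong2[where f = map_pmf] Pi_pmf_cong) (auto simp: edge_probs_label_mat)

text \<open>A finite set that carries every edge law, so that expectations become finite sums.\<close>
definition graphs :: "nat \<Rightarrow> nat \<Rightarrow> (nat \<times> nat \<Rightarrow> bool) set" where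
  "graphs n m = PiE_dflt ({..<n} \<times> {..<m}) False (\<lambda>_. UNIV)"

lemma finite_graphs [simp]: "finite (graphs n m)"
  unfolding graphs_def by (intro finite_PiE_dflt) auto

lemma set_edge_law: "set_pmf (edge_law n m p q Z W) \<subseteq> graphs n m"
  unfolding edge_law_def graphs_def
  by (rule order_trans[OF set_Pi_pmf_subset]) (auto simp: PiE_dflt_def)

lemma expectation_edge_law:
  fixes g :: "_ \<Rightarrow> real"
  shows "measure_pmf.expectation (edge_law n m p q Z W) g =
           (\<Sum>e\<in>graphs n m. pmf (edge_law n m p q Z W) e * g e)"
  by (subst integral_measure_pmf_real[OF finite_graphs[of n m]])
     (use subsetD[OF set_edge_law] in \<open>auto simp: mult.commute\<close>)

lemma prob_edge_law:
  "measure_pmf.prob (edge_law n m p q Z W) {e. Q e} =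
     (\<Sum>e\<in>graphs n m. pmf (edge_law n m p q Z W) e * of_bool (Q e))"
  using expectation_edge_law[of n m p q Z W "indicator {e. Q e}"]
  by (simp add: indicator_def of_bool_def)

section \<open>A likelihood-preserving relabelling\<close>

text \<open>The columns of the column pairs in which row \<open>u\<close> or its mate has an edge. Whole column pairs are
  taken, so that exchanging the labels of touched columns preserves transversals.\<close>
definition touched :: "nat \<Rightarrow> nat \<Rightarrow> (nat \<times> nat \<Rightarrow> bool) \<Rightarrow> nat set" where
  "touched m u e = {j \<in> paired m. \<exists>i\<in>{u, mate u}. \<exists>k\<in>{j, mate j}. e (i, k)}"

text \<open>The event that the matrix tells nothing about the orientation of the row pair of \<open>u\<close>: a column
  pair met by these two rows is met by no other row, so its own orientation can only be inferred
  from the two rows themselves. An unpaired column has a fixed label and would reveal the labels of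
  the rows that meet it; hence the two rows must avoid it.\<close>
definition isolated :: "nat \<Rightarrow> nat \<Rightarrow> nat \<Rightarrow> (nat \<times> nat \<Rightarrow> bool) \<Rightarrow> bool" where
  "isolated n m u e \<longleftrightarrow>
     (\<forall>j\<in>touched m u e. \<forall>i<n. e (i, j) \<longrightarrow> i \<in> {u, mate u}) \<and>
     (\<forall>j<m. j \<notin> paired m \<longrightarrow> \<not> e (u, j) \<and> \<not> e (mate u, j))"

lemma mate_touched: "j \<in> touched m u e \<Longrightarrow> mate j \<in> touched m u e"
  by (auto simp: touched_def)

text \<open>The exact symmetry behind the lower bound. Both sides are products over the cells of the matrix,
  and the permutation \<open>\<sigma>\<close> of the cells matches their factors. In a touched column pair the labels of
  the two rows and of the two columns are all reversed, so the factors in the two rows are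
  unchanged; the other rows are empty there, and \<open>\<sigma>\<close> exchanges the two columns to undo the reversal
  of their labels. In any other column only the two row labels are reversed; the two rows are empty
  there, and \<open>\<sigma>\<close> exchanges them.\<close>
lemma pmf_edge_law_flip:
  assumes "Z \<in> transversals n" "W \<in> transversals m" "u \<in> paired n"
    and iso: "isolated n m u e" and e: "e \<in> graphs n m"
  shows "pmf (edge_law n m p q (flip {u, mate u} Z) (flip (touched m u e) W)) e =
           pmf (edge_law n m p q Z W) e"
proof -
  define D where "D = {..<n} \<times> {..<m}"
  define T where "T = touched m u e"
  define \<sigma> where "\<sigma> = (\<lambda>(i, j). if j \<in> T then (if i \<in> {u, mate u} then (i, j) else (i, mate j))
                               else (if i \<in> {u, mate u} then (mate i, j) else (i, j)))"
  define w where "w = (\<lambda>Z W (i, j). pmf (bernoulli_pmf (if i \<in> Z \<longleftrightarrow> j \<in> W then p else q)) (e (i, j)))"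
  have pmf_eq: "pmf (edge_law n m p q Z W) e = (\<Prod>x\<in>D. w Z W x)" for Z W
    unfolding edge_law_def D_def w_def
    using e by (subst pmf_Pi') (auto simp: graphs_def PiE_dflt_def case_prod_unfold)
  have mT: "mate j \<in> T \<longleftrightarrow> j \<in> T" for j
    unfolding T_def using mate_touched[of j] mate_touched[of "mate j"] by auto
  have mu: "mate i \<in> {u, mate u} \<longleftrightarrow> i \<in> {u, mate u}" for i
    by (auto simp: mate_eq_iff)
  have Tp: "T \<subseteq> paired m"
    by (auto simp: T_def touched_def)
  have u: "i \<in> {u, mate u} \<Longrightarrow> i \<in> paired n" for i
    using assms(3) by auto
  have \<sigma>\<sigma>: "\<sigma> (\<sigma> x) = x" for x
    by (cases x) (auto simp: \<sigma>_def mT mu mate_eq_iff)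
  have \<sigma>D: "\<sigma> x \<in> D" if "x \<in> D" for x
    using that Tp u by (cases x) (auto simp: \<sigma>_def D_def intro: mate_less paired_less)
  have Zm: "mate i \<in> Z \<longleftrightarrow> i \<notin> Z" if "i \<in> paired n" for i
    using assms(1) that by (auto simp: transversals_def)
  have Wm: "mate j \<in> W \<longleftrightarrow> j \<notin> W" if "j \<in> paired m" for j
    using assms(2) that by (auto simp: transversals_def)
  have e_other: "\<not> e (i, j)" if "i < n" "j \<in> T" "i \<notin> {u, mate u}" for i j
    using iso that by (auto simp: isolated_def T_def)
  have e_own: "\<not> e (i, j)" if "j < m" "j \<notin> T" "i \<in> {u, mate u}" for i j
    using iso that by (auto simp: isolated_def T_def touched_def)
  have w\<sigma>: "w Z W (\<sigma> x) = w (flip {u, mate u} Z) (flip T W) x" if "x \<in> D" for x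
  proof -
    obtain i j where "x = (i, j)"
      by (cases x)
    with that have x: "x = (i, j)" "i < n" "j < m"
      by (auto simp: D_def)
    consider "j \<in> T" "i \<in> {u, mate u}" | "j \<in> T" "i \<notin> {u, mate u}"
      | "j \<notin> T" "i \<in> {u, mate u}" | "j \<notin> T" "i \<notin> {u, mate u}"
      by blast
    thus ?thesis
    proof cases
      case 1
      hence "i \<in> flip {u, mate u} Z \<longleftrightarrow> i \<notin> Z" "j \<in> flip T W \<longleftrightarrow> j \<notin> W"
        unfolding mem_flip_iff by blast+
      hence "(i \<in> flip {u, mate u} Z \<longleftrightarrow> j \<in> flip T W) = (i \<in> Z \<longleftrightarrow> j \<in> W)"
        by blast
      moreover have "\<sigma> (i, j) = (i, j)"
        using 1 unfolding \<sigma>_def prod.case by (simp only: if_True)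
      ultimately show ?thesis
        by (simp only: x(1) w_def prod.case)
    next
      case 2
      hence "\<not> e (i, j)" "\<not> e (i, mate j)" "mate j \<in> W \<longleftrightarrow> j \<notin> W"
        using e_other x mT Wm Tp by auto
      thus ?thesis using 2 by (simp add: x \<sigma>_def w_def mem_flip_iff)
    next
      case 3
      hence "\<not> e (i, j)" "\<not> e (mate i, j)" "mate i \<in> Z \<longleftrightarrow> i \<notin> Z"
        using e_own[of j i] e_own[of j "mate i"] x mu Zm u by blast+
      moreover have "i \<in> flip {u, mate u} Z \<longleftrightarrow> i \<notin> Z" "j \<in> flip T W \<longleftrightarrow> j \<in> W"
        using 3 unfolding mem_flip_iff by blast+
      moreover have "\<sigma> (i, j) = (mate i, j)"
        using 3 unfolding \<sigma>_def prod.case by (simp only: if_True if_False)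
      ultimately show ?thesis
        by (simp add: x(1) w_def)
    next
      case 4
      thus ?thesis by (simp add: x \<sigma>_def w_def mem_flip_iff)
    qed
  qed
  have "(\<Prod>x\<in>D. w (flip {u, mate u} Z) (flip T W) x) = (\<Prod>x\<in>D. w Z W x)"
    by (rule prod.reindex_bij_witness[where i = \<sigma> and j = \<sigma>]) (auto simp: \<sigma>\<sigma> \<sigma>D w\<sigma>)
  thus ?thesis
    by (simp add: pmf_eq T_def)
qed

text \<open>Whether two nodes are wrongly put together or wrongly separated does not change when the
  communities are renamed, which removes the permutation from the loss.\<close>
definition pair_error :: "(nat \<Rightarrow> nat) \<Rightarrow> nat set \<Rightarrow> nat \<Rightarrow> nat \<Rightarrow> bool" where
  "pair_error f Z u v \<longleftrightarrow> ((f u = f v) \<noteq> (u \<in> Z \<longleftrightarrow> v \<in> Z))"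

text \<open>Under the uniform prior on \<open>G\<close>, the relabelling of \<open>pmf_edge_law_flip\<close> pairs up parameters of equal
  likelihood. It reverses the label of \<open>u\<close> and keeps that of \<open>v\<close>, so whatever the estimator says
  about this pair is wrong for exactly one of the two parameters.\<close>
lemma posterior_pair_error:
  fixes n m :: nat
  defines "G \<equiv> transversals n \<times> transversals m"
  assumes "u \<in> paired n" "v \<notin> {u, mate u}" "isolated n m u e" "e \<in> graphs n m"
  shows "(\<Sum>(Z, W)\<in>G. pmf (edge_law n m p q Z W) e * of_bool (pair_error f Z u v)) =
           (\<Sum>(Z, W)\<in>G. pmf (edge_law n m p q Z W) e) / 2"
proof -
  define \<phi> where "\<phi> = map_prod (flip {u, mate u}) (flip (touched m u e))"
  define w where "w = (\<lambda>x. pmf (edge_law n m p q (fst x) (snd x)) e)"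
  define b where "b = (\<lambda>x :: nat set \<times> nat set. of_bool (pair_error f (fst x) u v) :: real)"
  have bij: "bij_betw \<phi> G G"
    unfolding \<phi>_def G_def
    by (intro bij_betw_map_prod bij_betw_flip_transversals)
       (use assms(2) mate_touched in \<open>auto simp: touched_def\<close>)
  have w\<phi>: "w (\<phi> x) = w x" if "x \<in> G" for x
    using pmf_edge_law_flip[of "fst x" n "snd x" m u e p q] that assms
    by (cases x) (auto simp: w_def \<phi>_def)
  have b\<phi>: "b (\<phi> x) = 1 - b x" for x
    using assms(3) by (cases x) (auto simp: b_def \<phi>_def pair_error_def mem_flip_iff)
  have "(\<Sum>x\<in>G. w x * b x) = (\<Sum>x\<in>G. w (\<phi> x) * b (\<phi> x))"
    by (rule sum.reindex_bij_betw[OF bij, symmetric])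
  also have "\<dots> = (\<Sum>x\<in>G. w x * (1 - b x))"
    by (intro sum.cong) (auto simp: w\<phi> b\<phi>)
  also have "\<dots> = (\<Sum>x\<in>G. w x) - (\<Sum>x\<in>G. w x * b x)"
    by (simp add: right_diff_distrib sum_subtractf)
  finally show ?thesis
    by (simp add: w_def b_def case_prod_unfold)
qed

section \<open>From pair errors to the minimax risk\<close>

text \<open>A pair on which \<open>f\<close> and \<open>z\<close> disagree contains a node at which \<open>f\<close> differs from \<open>\<pi> \<circ> z\<close>, and a node
  belongs to at most \<open>2 n\<close> ordered pairs.\<close>
lemma pairs_disagreement_le:
  fixes f z :: "nat \<Rightarrow> nat"
  assumes "inj \<pi>"
  shows "(\<Sum>u<n. \<Sum>v<n. of_bool ((f u = f v) \<noteq> (z u = z v))) \<le>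
           2 * real n * (\<Sum>i<n. of_bool (f i \<noteq> \<pi> (z i)))"
proof -
  let ?b = "\<lambda>i. of_bool (f i \<noteq> \<pi> (z i)) :: real"
  have "of_bool ((f u = f v) \<noteq> (z u = z v)) \<le> ?b u + ?b v" for u v
    using assms by (auto simp: inj_eq)
  hence "(\<Sum>u<n. \<Sum>v<n. of_bool ((f u = f v) \<noteq> (z u = z v))) \<le> (\<Sum>u<n. \<Sum>v<n. ?b u + ?b v)"
    by (intro sum_mono)
  thus ?thesis
    by (simp add: sum.distrib sum_distrib_left[symmetric] algebra_simps)
qed

lemma misclustering_ge_pairs:
  assumes "n > 0"
  shows "misclustering n K f z \<ge>
           (\<Sum>u<n. \<Sum>v<n. of_bool ((f u = f v) \<noteq> (z u = z v))) / (2 * (real n)\<^sup>2)"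
proof -
  let ?S = "{\<pi>. \<pi> permutes {..<K}}" and ?l = "\<lambda>\<pi>. \<Sum>i<n. of_bool (f i \<noteq> \<pi> (z i)) :: real"
  have "Min (?l ` ?S) \<in> ?l ` ?S"
    by (intro Min_in) (auto intro!: finite_permutations permutes_id)
  then obtain \<pi> where \<pi>: "\<pi> permutes {..<K}" "Min (?l ` ?S) = ?l \<pi>"
    by auto
  show ?thesis
    using pairs_disagreement_le[OF permutes_inj[OF \<pi>(1)], where n = n and f = f and z = z] assms
    unfolding misclustering_def \<pi>(2) by (simp add: field_simps power2_eq_square)
qed

lemma misclustering_cong:
  assumes "\<And>i. i < n \<Longrightarrow> z i = z' i"
  shows "misclustering n K f z = misclustering n K f z'"
proof -
  have "(\<lambda>\<pi>. \<Sum>i<n. of_bool (f i \<noteq> \<pi> (z i)) :: real) = (\<lambda>\<pi>. \<Sum>i<n. of_bool (f i \<noteq> \<pi> (z' i)))"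
    by (intro ext sum.cong) (auto simp: assms)
  thus ?thesis
    by (simp only: misclustering_def)
qed

lemma misclustering_le_1: "misclustering n K f z \<le> 1"
proof -
  let ?S = "{\<pi>. \<pi> permutes {..<K}}" and ?l = "\<lambda>\<pi>. \<Sum>i<n. of_bool (f i \<noteq> \<pi> (z i)) :: real"
  have "Min (?l ` ?S) \<le> ?l id"
    by (intro Min_le) (auto intro!: finite_permutations image_eqI[of _ _ id] permutes_id)
  also have "?l id \<le> (\<Sum>i<n. 1)"
    by (intro sum_mono) auto
  finally show ?thesis
    by (cases "n = 0") (auto simp: misclustering_def field_simps)
qed

lemma card_mate_free_pairs:
  assumes "u \<in> paired n"
  shows "card ({..<n} - {u, mate u}) = n - 2"
  using assms paired_less[OF assms] mate_less[OF assms] by (simp add: card_Diff_subset)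

text \<open>Averaging over the prior: the loss is at least the number of pair errors over \<open>2 n\<^sup>2\<close>. There are at
  least \<open>(n - 1) (n - 2) \<ge> 3 n\<^sup>2 / 8\<close> ordered pairs \<open>(u, v)\<close> with \<open>u\<close> paired and \<open>v\<close> neither \<open>u\<close> nor its
  mate, and each of them is in error with probability at least \<open>\<pi> / 2\<close>.\<close>
lemma bayes_risk_ge:
  fixes n m :: nat and L :: "(nat \<times> nat \<Rightarrow> bool) \<Rightarrow> nat \<Rightarrow> nat" and \<pi> p q :: real
  defines "G \<equiv> transversals n \<times> transversals m"
  assumes n: "n \<ge> 4" and "\<pi> \<ge> 0"
    and iso: "\<And>Z W u. Z \<in> transversals n \<Longrightarrow> W \<in> transversals m \<Longrightarrow> u \<in> paired n \<Longrightarrow>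
       measure_pmf.prob (edge_law n m p q Z W) {e. isolated n m u e} \<ge> \<pi>"
  shows "(\<Sum>(Z, W)\<in>G. measure_pmf.expectation (edge_law n m p q Z W)
            (\<lambda>e. misclustering n 2 (L e) (\<lambda>i. of_bool (i \<in> Z)))) \<ge> real (card G) * (3 / 32 * \<pi>)"
proof -
  define P where "P = (\<lambda>x e. pmf (edge_law n m p q (fst x) (snd x)) e)"
  define err where "err = (\<lambda>x :: nat set \<times> nat set. \<lambda>e u v. of_bool (pair_error (L e) (fst x) u v) :: real)"
  define R where "R = (\<lambda>x. measure_pmf.expectation (edge_law n m p q (fst x) (snd x))
            (\<lambda>e. misclustering n 2 (L e) (\<lambda>i. of_bool (i \<in> fst x))))"
  let ?E = "graphs n m"
  have pair: "(\<Sum>x\<in>G. \<Sum>e\<in>?E. P x e * err x e u v) \<ge> real (card G) * \<pi> / 2"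
    if u: "u \<in> paired n" and v: "v \<in> {..<n} - {u, mate u}" for u v
  proof -
    have "real (card G) * \<pi> / 2 = (\<Sum>x\<in>G. \<pi>) / 2"
      by simp
    also have "\<dots> \<le> (\<Sum>x\<in>G. \<Sum>e\<in>?E. P x e * of_bool (isolated n m u e)) / 2"
      unfolding P_def prob_edge_law[symmetric]
      by (intro divide_right_mono sum_mono iso) (use u in \<open>auto simp: G_def\<close>)
    also have "\<dots> = (\<Sum>e\<in>?E. of_bool (isolated n m u e) * ((\<Sum>x\<in>G. P x e) / 2))"
      by (subst sum.swap) (simp add: sum_distrib_left sum_divide_distrib mult.commute)
    also have "\<dots> \<le> (\<Sum>e\<in>?E. \<Sum>x\<in>G. P x e * err x e u v)"
    proof (rule sum_mono)
      fix e assume e: "e \<in> ?E"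
      show "of_bool (isolated n m u e) * ((\<Sum>x\<in>G. P x e) / 2) \<le> (\<Sum>x\<in>G. P x e * err x e u v)"
      proof (cases "isolated n m u e")
        case True
        thus ?thesis
          using posterior_pair_error[OF u _ True e, of v p q "L e"] v
          by (simp add: G_def P_def err_def case_prod_unfold)
      qed (auto simp: P_def err_def intro!: sum_nonneg)
    qed
    also have "\<dots> = (\<Sum>x\<in>G. \<Sum>e\<in>?E. P x e * err x e u v)"
      by (rule sum.swap)
    finally show ?thesis .
  qed
  have "real (card G) * (3 / 32 * \<pi>) \<le>
          real (card (paired n)) * (real (n - 2) * (real (card G) * \<pi> / 2)) / (2 * (real n)\<^sup>2)"
  proof -
    have "real (card (paired n)) \<ge> real n - 1" "real (n - 2) = real n - 2" "real n \<ge> 4"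
      using n by (auto simp: paired_def)
    moreover have "3 / 8 * x\<^sup>2 \<le> (x - 1) * (x - 2)" if "x \<ge> 4" for x :: real
      using that mult_nonneg_nonneg[of "x - 4" "5 * x - 4"]
      by (simp add: power2_eq_square algebra_simps)
    ultimately have "3 / 8 * (real n)\<^sup>2 \<le> real (card (paired n)) * real (n - 2)"
      by (smt (verit) mult_right_mono)
    hence "(3 / 8 * (real n)\<^sup>2) * (real (card G) * \<pi> / 2) \<le>
             (real (card (paired n)) * real (n - 2)) * (real (card G) * \<pi> / 2)"
      using \<open>\<pi> \<ge> 0\<close> by (intro mult_right_mono) auto
    thus ?thesis
      using n by (simp add: field_simps)
  qed
  also have "\<dots> = (\<Sum>u\<in>paired n. \<Sum>v\<in>{..<n} - {u, mate u}. real (card G) * \<pi> / 2) / (2 * (real n)\<^sup>2)"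
    by (simp add: card_mate_free_pairs)
  also have "\<dots> \<le> (\<Sum>u\<in>paired n. \<Sum>v\<in>{..<n} - {u, mate u}. \<Sum>x\<in>G. \<Sum>e\<in>?E. P x e * err x e u v) / (2 * (real n)\<^sup>2)"
    by (intro divide_right_mono sum_mono pair) auto
  also have "\<dots> \<le> (\<Sum>u<n. \<Sum>v<n. \<Sum>x\<in>G. \<Sum>e\<in>?E. P x e * err x e u v) / (2 * (real n)\<^sup>2)"
    by (intro divide_right_mono order_trans[OF sum_mono sum_mono2] sum_mono2 sum_nonneg)
       (auto simp: P_def err_def paired_less)
  also have "(\<Sum>u<n. \<Sum>v<n. \<Sum>x\<in>G. \<Sum>e\<in>?E. P x e * err x e u v) =
               (\<Sum>u<n. \<Sum>x\<in>G. \<Sum>v<n. \<Sum>e\<in>?E. P x e * err x e u v)"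
    by (intro sum.cong refl sum.swap)
  also have "\<dots> = (\<Sum>x\<in>G. \<Sum>u<n. \<Sum>v<n. \<Sum>e\<in>?E. P x e * err x e u v)"
    by (rule sum.swap)
  also have "\<dots> = (\<Sum>x\<in>G. \<Sum>e\<in>?E. P x e * (\<Sum>u<n. \<Sum>v<n. err x e u v))"
    unfolding sum_distrib_left
    by (intro sum.cong refl) (simp only: sum.swap[where B = ?E])
  also have "\<dots> / (2 * (real n)\<^sup>2) =
      (\<Sum>x\<in>G. \<Sum>e\<in>?E. P x e * ((\<Sum>u<n. \<Sum>v<n. err x e u v) / (2 * (real n)\<^sup>2)))"
    unfolding times_divide_eq_right sum_divide_distrib[symmetric] ..
  also have "\<dots> \<le> (\<Sum>x\<in>G. R x)"
  proof (rule sum_mono)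
    fix x
    have "(\<Sum>u<n. \<Sum>v<n. err x e u v) / (2 * (real n)\<^sup>2) \<le>
            misclustering n 2 (L e) (\<lambda>i. of_bool (i \<in> fst x))" for e
    proof -
      have "err x e u v = of_bool ((L e u = L e v) \<noteq>
              ((of_bool (u \<in> fst x) :: nat) = of_bool (v \<in> fst x)))" for u v
        by (simp add: err_def pair_error_def)
      thus ?thesis
        using misclustering_ge_pairs[of n "L e" "\<lambda>i. of_bool (i \<in> fst x)" 2] n by simp
    qed
    thus "(\<Sum>e\<in>?E. P x e * ((\<Sum>u<n. \<Sum>v<n. err x e u v) / (2 * (real n)\<^sup>2))) \<le> R x"
      unfolding R_def expectation_edge_law P_def by (intro sum_mono mult_left_mono) auto
  qed
  finally show ?thesis
    by (simp add: R_def case_prod_unfold)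
qed

text \<open>A supremum over the parameters is at least the average over a finite set of them.\<close>
lemma minimax_risk_ge:
  fixes \<pi> :: real
  assumes "n \<ge> 4" "\<pi> \<ge> 0" and ne: "param_space n m 2 \<alpha> \<noteq> {}"
    and iso: "\<And>Z W u. Z \<in> transversals n \<Longrightarrow> W \<in> transversals m \<Longrightarrow> u \<in> paired n \<Longrightarrow>
       measure_pmf.prob (edge_law n m p q Z W) {e. isolated n m u e} \<ge> \<pi>"
  shows "minimax_risk n m 2 p q \<alpha> \<ge> 3 / 32 * \<pi>"
  unfolding minimax_risk_def
proof (rule cINF_greatest)
  show "estimators n 2 \<noteq> {}"
    by (auto simp: estimators_def intro!: exI[of _ "\<lambda>_ _. 0"])
next
  fix zh :: "real mat \<Rightarrow> nat \<Rightarrow> nat"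
  define risk where "risk = (\<lambda>(Z1, Z2). measure_pmf.expectation (SBiSBM Z1 Z2 p q)
          (\<lambda>A. misclustering n 2 (zh A) (partition_fun Z1)))"
  define L where "L = (\<lambda>e. zh (mat n m (\<lambda>ij. of_bool (e ij))))"
  define G where "G = transversals n \<times> transversals m"
  let ?S = "SUP \<theta>\<in>param_space n m 2 \<alpha>. risk \<theta>"
  have "risk \<theta> \<le> 1" for \<theta>
  proof (cases \<theta>)
    case (Pair Z1 Z2)
    let ?M = "measure_pmf (SBiSBM Z1 Z2 p q)"
      and ?r = "\<lambda>A. misclustering n 2 (zh A) (partition_fun Z1)"
    show ?thesis
    proof (cases "integrable ?M ?r")
      case True
      thus ?thesis
        unfolding risk_def Pair prod.case
        by (rule measure_pmf.integral_le_const) (simp add: misclustering_le_1)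
    qed (simp add: risk_def Pair not_integrable_integral_eq)
  qed
  hence bdd: "bdd_above (risk ` param_space n m 2 \<alpha>)"
    by (intro bdd_aboveI2)
  have risk_label: "risk (label_mat n Z, label_mat m W) =
      measure_pmf.expectation (edge_law n m p q Z W)
        (\<lambda>e. misclustering n 2 (L e) (\<lambda>i. of_bool (i \<in> Z)))" for Z W
    using misclustering_cong[of n "partition_fun (label_mat n Z)" "\<lambda>i. of_bool (i \<in> Z)"]
    by (simp add: risk_def SBiSBM_label_mat L_def partition_fun_label_mat)
  have "real (card G) * (3 / 32 * \<pi>) \<le>
      (\<Sum>(Z, W)\<in>G. measure_pmf.expectation (edge_law n m p q Z W)
            (\<lambda>e. misclustering n 2 (L e) (\<lambda>i. of_bool (i \<in> Z))))"
    unfolding G_def by (rule bayes_risk_ge) (use assms in auto)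
  also have "\<dots> \<le> (\<Sum>(Z, W)\<in>G. ?S)"
    using label_mats_in_param_space[OF ne]
    by (intro sum_mono) (auto simp: G_def risk_label[symmetric] intro!: cSUP_upper bdd)
  also have "\<dots> = real (card G) * ?S"
    by simp
  finally have "real (card G) * (3 / 32 * \<pi>) \<le> real (card G) * ?S" .
  moreover have "card G > 0"
    by (auto simp: G_def card_gt_0_iff transversals_nonempty)
  ultimately show "3 / 32 * \<pi> \<le> (SUP (Z1, Z2)\<in>param_space n m 2 \<alpha>.
        measure_pmf.expectation (SBiSBM Z1 Z2 p q)
          (\<lambda>A. misclustering n 2 (zh A) (partition_fun Z1)))"
    by (simp add: risk_def)
qed

section \<open>Product laws on Boolean arrays\<close>

text \<open>Only the countable supports matter, so the product rule for countable events extends to all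
  events.\<close>
lemma prob_pair_pmf_Times:
  "measure_pmf.prob (pair_pmf M N) (A \<times> B) = measure_pmf.prob M A * measure_pmf.prob N B"
proof -
  have "measure_pmf.prob (pair_pmf M N) (A \<times> B) =
          measure_pmf.prob (pair_pmf M N) ((A \<inter> set_pmf M) \<times> (B \<inter> set_pmf N))"
    using measure_Int_set_pmf[of "pair_pmf M N" "A \<times> B"] by (simp add: Times_Int_Times)
  also have "\<dots> = measure_pmf.prob M (A \<inter> set_pmf M) * measure_pmf.prob N (B \<inter> set_pmf N)"
    by (rule measure_pmf_prob_product) auto
  finally show ?thesis
    by (simp add: measure_Int_set_pmf)
qed

text \<open>Events that depend on disjoint blocks of coordinates are independent under a product law.\<close>
lemma prob_Pi_pmf_blocks:
  fixes B :: "'t \<Rightarrow> 'a set" and D :: "'a \<Rightarrow> 'b pmf"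
  assumes "finite I" "\<And>t. t \<in> I \<Longrightarrow> finite (B t)" "disjoint_family_on B I"
    and dep: "\<And>t e e'. t \<in> I \<Longrightarrow> (\<And>x. x \<in> B t \<Longrightarrow> e x = e' x) \<Longrightarrow> Q t e \<longleftrightarrow> Q t e'"
  shows "measure_pmf.prob (Pi_pmf (\<Union>t\<in>I. B t) d D) {e. \<forall>t\<in>I. Q t e} =
           (\<Prod>t\<in>I. measure_pmf.prob (Pi_pmf (B t) d D) {e. Q t e})"
  using assms
proof (induction I rule: finite_induct)
  case (insert s I)
  have disj: "B s \<inter> (\<Union>t\<in>I. B t) = {}" "disjoint_family_on B I"
    using insert.prems(2) insert.hyps by (auto simp: disjoint_family_on_def)
  let ?A = "\<Union>t\<in>I. B t" and ?\<mu> = "\<lambda>A. Pi_pmf A d D"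
  let ?join = "\<lambda>(f, g) x. if x \<in> B s then f x else g x"
  have "measure_pmf.prob (?\<mu> (\<Union>t\<in>insert s I. B t)) {e. \<forall>t\<in>insert s I. Q t e} =
          measure_pmf.prob (pair_pmf (?\<mu> (B s)) (?\<mu> ?A)) (?join -` {e. \<forall>t\<in>insert s I. Q t e})"
    using insert.prems(1) insert.hyps disj Pi_pmf_union[of "B s" ?A d D] by simp
  also have "?join -` {e. \<forall>t\<in>insert s I. Q t e} = {f. Q s f} \<times> {g. \<forall>t\<in>I. Q t g}"
  proof -
    have "Q s (?join (f, g)) \<longleftrightarrow> Q s f" for f g
      by (rule insert.prems(3)) auto
    moreover have "Q t (?join (f, g)) \<longleftrightarrow> Q t g" if "t \<in> I" for t f g
      by (rule insert.prems(3)) (use that disj in auto)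
    ultimately show ?thesis by auto
  qed
  also have "measure_pmf.prob (pair_pmf (?\<mu> (B s)) (?\<mu> ?A)) \<dots> =
      measure_pmf.prob (?\<mu> (B s)) {f. Q s f} * measure_pmf.prob (?\<mu> ?A) {g. \<forall>t\<in>I. Q t g}"
    by (rule prob_pair_pmf_Times)
  also have "measure_pmf.prob (?\<mu> ?A) {g. \<forall>t\<in>I. Q t g} =
      (\<Prod>t\<in>I. measure_pmf.prob (?\<mu> (B t)) {e. Q t e})"
  proof (rule insert.IH)
    show "finite (B t)" if "t \<in> I" for t
      using insert.prems(1) that by blast
    show "Q t e \<longleftrightarrow> Q t e'" if "t \<in> I" "\<And>x. x \<in> B t \<Longrightarrow> e x = e' x" for t e e'
      by (rule insert.prems(3)) (use that in blast)+
  qed (rule disj)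
  finally show ?case
    using insert.hyps by simp
qed simp

lemma prob_all_edges_le:
  fixes D :: "'a \<Rightarrow> bool pmf"
  assumes "finite A" "F \<subseteq> A" "\<And>x. x \<in> A \<Longrightarrow> pmf (D x) True \<le> p"
  shows "measure_pmf.prob (Pi_pmf A d D) {e. \<forall>x\<in>F. e x} \<le> p ^ card F"
proof -
  have "{e. \<forall>x\<in>F. e x} = Pi A (\<lambda>x. if x \<in> F then {True} else UNIV)"
    using assms(2) by (fastforce split: if_splits)
  hence "measure_pmf.prob (Pi_pmf A d D) {e. \<forall>x\<in>F. e x} =
      (\<Prod>x\<in>A. measure_pmf.prob (D x) (if x \<in> F then {True} else UNIV))"
    using assms(1) by (simp only: measure_Pi_pmf_Pi)
  also have "\<dots> = (\<Prod>x\<in>A. if x \<in> F then pmf (D x) True else 1)"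
    by (intro prod.cong) (auto simp: measure_pmf_single)
  also have "\<dots> = (\<Prod>x\<in>F. pmf (D x) True)"
    using assms(1,2) by (simp add: prod.inter_restrict[symmetric] Int_absorb1)
  also have "\<dots> \<le> (\<Prod>x\<in>F. p)"
    using assms(2,3) by (intro prod_mono) auto
  finally show ?thesis by simp
qed

text \<open>Union bound over the sets \<open>F \<in> K\<close>, each of which is fully present with probability at most \<open>p ^ k\<close>.\<close>
lemma prob_no_pattern_ge:
  fixes D :: "'a \<Rightarrow> bool pmf"
  assumes "finite A" "finite K" "\<And>F. F \<in> K \<Longrightarrow> F \<subseteq> A \<and> card F = k"
    and "\<And>x. x \<in> A \<Longrightarrow> pmf (D x) True \<le> p"
  shows "measure_pmf.prob (Pi_pmf A d D) {e. \<forall>F\<in>K. \<exists>x\<in>F. \<not> e x} \<ge> 1 - real (card K) * p ^ k"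
proof -
  let ?M = "measure_pmf (Pi_pmf A d D)"
  have "measure ?M (\<Union>F\<in>K. {e. \<forall>x\<in>F. e x}) \<le> (\<Sum>F\<in>K. measure ?M {e. \<forall>x\<in>F. e x})"
    using assms(2) by (rule measure_UNION_le) auto
  also have "\<dots> \<le> (\<Sum>F\<in>K. p ^ k)"
  proof (rule sum_mono)
    fix F assume "F \<in> K"
    thus "measure ?M {e. \<forall>x\<in>F. e x} \<le> p ^ k"
      using prob_all_edges_le[of A F D p d] assms by simp
  qed
  finally have "measure ?M (\<Union>F\<in>K. {e. \<forall>x\<in>F. e x}) \<le> real (card K) * p ^ k"
    by simp
  moreover have "measure ?M (space ?M - (\<Union>F\<in>K. {e. \<forall>x\<in>F. e x})) =
      1 - measure ?M (\<Union>F\<in>K. {e. \<forall>x\<in>F. e x})"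
    by (rule measure_pmf.prob_compl) simp
  moreover have "space ?M - (\<Union>F\<in>K. {e. \<forall>x\<in>F. e x}) = {e. \<forall>F\<in>K. \<exists>x\<in>F. \<not> e x}"
    by auto
  ultimately show ?thesis
    by simp
qed

section \<open>The probability of isolation\<close>

lemma one_minus_ge_exp:
  fixes x :: real
  assumes "0 \<le> x" "x \<le> 1 / 2"
  shows "exp (- 2 * x) \<le> 1 - x"
proof -
  have "1 \<le> (1 - x) * (1 + 2 * x)"
    using assms mult_left_mono[of "2 * x" 1 x] by (simp add: algebra_simps)
  also have "\<dots> \<le> (1 - x) * exp (2 * x)"
    using assms by (intro mult_left_mono exp_ge_add_one_self) auto
  finally show ?thesis
    by (simp add: exp_minus field_simps)
qed

text \<open>The column pair number \<open>t\<close>. The block number \<open>m div 2\<close> is empty for even \<open>m\<close> and consists of the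
  unpaired column for odd \<open>m\<close>.\<close>
definition column_block :: "nat \<Rightarrow> nat \<Rightarrow> nat set" where
  "column_block m t = {j. j < m \<and> j div 2 = t}"

lemma card_column_block_le: "card (column_block m t) \<le> 2"
proof -
  have "column_block m t \<subseteq> {2 * t, 2 * t + 1}"
    by (auto simp: column_block_def)
  hence "card (column_block m t) \<le> card {2 * t, 2 * t + 1}"
    by (intro card_mono) auto
  thus ?thesis by simp
qed

lemma finite_column_block [simp]: "finite (column_block m t)"
  by (simp add: column_block_def)

lemma card_last_block_le: "card (column_block m (m div 2)) \<le> 1"
proof -
  have "column_block m (m div 2) \<subseteq> {m - 1}"
    by (auto simp: column_block_def)
  hence "card (column_block m (m div 2)) \<le> card {m - 1}"
    by (intro card_mono) auto
  thus ?thesis by simp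
qed

text \<open>The minimal sets of edges in column block \<open>t\<close> that prevent the isolation of \<open>u\<close>: an edge in the
  two rows together with an edge in another row for a column pair, and a single edge in the two rows
  for the unpaired column.\<close>
definition obstructions :: "nat \<Rightarrow> nat \<Rightarrow> nat \<Rightarrow> nat \<Rightarrow> (nat \<times> nat) set set" where
  "obstructions n m u t =
     (if t < m div 2
      then (\<lambda>(x, y). {x, y}) `
             (({u, mate u} \<times> column_block m t) \<times> (({..<n} - {u, mate u}) \<times> column_block m t))
      else (\<lambda>x. {x}) ` ({u, mate u} \<times> column_block m t))"

lemma isolatedI:
  assumes "\<And>t F. t \<le> m div 2 \<Longrightarrow> F \<in> obstructions n m u t \<Longrightarrow> \<exists>x\<in>F. \<not> e x"
  shows "isolated n m u e"
  unfolding isolated_def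
proof (intro conjI ballI allI impI)
  fix i j assume j: "j \<in> touched m u e" and i: "i < n" "e (i, j)"
  then obtain i' j' where ij': "i' \<in> {u, mate u}" "j' \<in> {j, mate j}" "e (i', j')"
    and jp: "j \<in> paired m"
    by (auto simp: touched_def)
  have t: "j div 2 < m div 2" "j \<in> column_block m (j div 2)" "j' \<in> column_block m (j div 2)"
    using jp ij'(2) paired_less[OF jp] mate_less[OF jp]
    by (auto simp: paired_def column_block_def) (auto simp: mate_def elim!: oddE)
  show "i \<in> {u, mate u}"
  proof (rule ccontr)
    assume "i \<notin> {u, mate u}"
    hence "{(i', j'), (i, j)} \<in> obstructions n m u (j div 2)"
      using t ij' i by (force simp: obstructions_def)
    from assms[OF _ this] t ij' i show False by auto
  qed
next
  have "\<not> e (i, j)" if "i \<in> {u, mate u}" "j < m" "j \<notin> paired m" for i j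
  proof
    assume "e (i, j)"
    \<comment> \<open>For an unpaired column, \<open>m\<close> is odd and \<open>j = m - 1\<close>.\<close>
    have "j \<in> column_block m (m div 2)"
      using that by (auto simp: column_block_def paired_def)
    hence "{(i, j)} \<in> obstructions n m u (m div 2)"
      using that by (auto simp: obstructions_def)
    from assms[OF _ this] \<open>e (i, j)\<close> show False by auto
  qed
  thus "\<not> e (u, j)" "\<not> e (mate u, j)" if "j < m" "j \<notin> paired m" for j
    using that by auto
qed

text \<open>The column blocks are independent. A column pair has at most \<open>8 n\<close> obstructions, each of probability
  at most \<open>p\<^sup>2\<close>, so it is harmless with probability at least \<open>1 - 8 n p\<^sup>2 \<ge> exp (- 16 n p\<^sup>2)\<close>; there are
  at most \<open>m / 2\<close> such pairs. The unpaired column contributes only a constant factor.\<close>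
lemma prob_isolated_ge:
  assumes u: "u \<in> paired n" and pq: "0 \<le> q" "q \<le> p" "0 < p" and small: "16 * real n * p\<^sup>2 \<le> 1"
  shows "measure_pmf.prob (edge_law n m p q Z W) {e. isolated n m u e} \<ge>
           exp (- 8 * (real n * real m * p\<^sup>2)) / 2"
proof -
  define D where "D = (\<lambda>(i, j). bernoulli_pmf (if i \<in> Z \<longleftrightarrow> j \<in> W then p else q))"
  define B where "B = (\<lambda>t. {..<n} \<times> column_block m t)"
  define Q where "Q = (\<lambda>t e. \<forall>F\<in>obstructions n m u t. \<exists>x\<in>F. \<not> e x)"
  let ?I = "{..m div 2}"
  have n2: "n \<ge> 2"
    using paired_less[OF u] mate_less[OF u] mate_neq(1)[of u] by arith
  \<comment> \<open>The bound on \<open>n p\<^sup>2\<close> also makes \<open>p\<close> itself small, since \<open>n \<ge> 2\<close>; this settles the unpaired column.\<close>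
  have "4 * p\<^sup>2 * 8 \<le> 16 * real n * p\<^sup>2"
    using n2 by (simp add: mult_right_mono)
  also have "\<dots> \<le> 1"
    by (rule small)
  finally have "(2 * p)\<^sup>2 \<le> (1 / 2)\<^sup>2"
    by (simp add: power_mult_distrib power_divide)
  hence p: "2 * p \<le> 1 / 2"
    by (rule power2_le_imp_le) simp
  have own: "{u, mate u} \<subseteq> {..<n}"
    using paired_less[OF u] mate_less[OF u] by auto
  have D: "pmf (D x) True \<le> p" for x
    using pq p by (cases x) (auto simp: D_def)
  have fin: "finite (B t)" for t
    by (simp add: B_def)
  have blocks: "{..<n} \<times> {..<m} = (\<Union>t\<in>?I. B t)"
    by (auto simp: B_def column_block_def intro: div_le_mono)
  have "measure_pmf.prob (edge_law n m p q Z W) {e. isolated n m u e} \<ge>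
          measure_pmf.prob (edge_law n m p q Z W) {e. \<forall>t\<in>?I. Q t e}"
    by (intro measure_pmf.finite_measure_mono) (auto simp: Q_def intro!: isolatedI)
  also have "measure_pmf.prob (edge_law n m p q Z W) {e. \<forall>t\<in>?I. Q t e} =
      (\<Prod>t\<in>?I. measure_pmf.prob (Pi_pmf (B t) False D) {e. Q t e})"
    unfolding edge_law_def D_def[symmetric] blocks
  proof (rule prob_Pi_pmf_blocks)
    show "disjoint_family_on B ?I"
      by (auto simp: disjoint_family_on_def B_def column_block_def)
    fix t and e e' :: "nat \<times> nat \<Rightarrow> bool"
    assume *: "\<And>x. x \<in> B t \<Longrightarrow> e x = e' x"
    have "F \<subseteq> B t" if "F \<in> obstructions n m u t" for F
      using that own by (auto simp: obstructions_def B_def split: if_splits)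
    thus "Q t e \<longleftrightarrow> Q t e'"
      using * unfolding Q_def by (meson subsetD)
  qed (auto simp: fin)
  finally have "measure_pmf.prob (edge_law n m p q Z W) {e. isolated n m u e} \<ge>
      (\<Prod>t\<in>?I. measure_pmf.prob (Pi_pmf (B t) False D) {e. Q t e})" .
  moreover have pair_block: "measure_pmf.prob (Pi_pmf (B t) False D) {e. Q t e} \<ge> exp (- 16 * (real n * p\<^sup>2))"
    if t: "t < m div 2" for t
  proof -
    let ?X = "({u, mate u} \<times> column_block m t) \<times> (({..<n} - {u, mate u}) \<times> column_block m t)"
    have "card (obstructions n m u t) \<le> card ?X"
      unfolding obstructions_def if_P[OF t] by (rule card_image_le) simp
    also have "\<dots> = card {u, mate u} * card (column_block m t) * (card ({..<n} - {u, mate u}) * card (column_block m t))"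
      by (simp only: card_cartesian_product)
    also have "\<dots> \<le> 2 * 2 * (n * 2)"
      by (intro mult_mono card_column_block_le) (auto simp: card_mate_free_pairs[OF u] card_insert_if)
    finally have "real (card (obstructions n m u t)) \<le> 8 * real n"
      by simp
    hence "1 - 8 * real n * p\<^sup>2 \<le> 1 - real (card (obstructions n m u t)) * p ^ 2"
      by (simp add: mult_right_mono)
    also have "\<dots> \<le> measure_pmf.prob (Pi_pmf (B t) False D) {e. Q t e}"
      unfolding Q_def
    proof (rule prob_no_pattern_ge[OF fin])
      fix F assume "F \<in> obstructions n m u t"
      thus "F \<subseteq> B t \<and> card F = 2"
        using t own by (auto simp: obstructions_def B_def)
    qed (use t D in \<open>auto simp: obstructions_def\<close>)
    finally show ?thesis
      using one_minus_ge_exp[of "8 * real n * p\<^sup>2"] small by simp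
  qed
  moreover have last_block: "measure_pmf.prob (Pi_pmf (B (m div 2)) False D) {e. Q (m div 2) e} \<ge> 1 / 2"
  proof -
    let ?t = "m div 2"
    have "card (obstructions n m u ?t) \<le> card ({u, mate u} \<times> column_block m ?t)"
      unfolding obstructions_def if_not_P[OF less_irrefl] by (rule card_image_le) simp
    also have "\<dots> \<le> 2 * 1"
      unfolding card_cartesian_product
      by (intro mult_mono card_last_block_le) (auto simp: card_insert_if)
    finally have "real (card (obstructions n m u ?t)) * p \<le> 2 * p"
      using pq by (intro mult_right_mono) auto
    hence "1 / 2 \<le> 1 - real (card (obstructions n m u ?t)) * p ^ 1"
      using p by simp
    also have "\<dots> \<le> measure_pmf.prob (Pi_pmf (B ?t) False D) {e. Q ?t e}"
      unfolding Q_def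
    proof (rule prob_no_pattern_ge[OF fin])
      fix F assume "F \<in> obstructions n m u ?t"
      thus "F \<subseteq> B ?t \<and> card F = 1"
        using own by (auto simp: obstructions_def B_def)
    qed (use D in \<open>auto simp: obstructions_def\<close>)
    finally show ?thesis .
  qed
  moreover have "exp (- 8 * (real n * real m * p\<^sup>2)) / 2 \<le>
      (\<Prod>t\<in>?I. measure_pmf.prob (Pi_pmf (B t) False D) {e. Q t e})"
  proof -
    have "real (m div 2) \<le> real m / 2"
      by linarith
    hence "16 * (real n * p\<^sup>2) * real (m div 2) \<le> 16 * (real n * p\<^sup>2) * (real m / 2)"
      by (intro mult_left_mono) auto
    hence "exp (- 8 * (real n * real m * p\<^sup>2)) \<le> exp (- 16 * (real n * p\<^sup>2)) ^ (m div 2)"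
      by (simp add: exp_of_nat_mult[symmetric] mult.commute mult.left_commute)
    also have "\<dots> = (\<Prod>t<m div 2. exp (- 16 * (real n * p\<^sup>2)))"
      by simp
    also have "\<dots> \<le> (\<Prod>t<m div 2. measure_pmf.prob (Pi_pmf (B t) False D) {e. Q t e})"
      using pair_block by (intro prod_mono) auto
    finally have "exp (- 8 * (real n * real m * p\<^sup>2)) * (1 / 2) \<le>
        (\<Prod>t<m div 2. measure_pmf.prob (Pi_pmf (B t) False D) {e. Q t e}) *
        measure_pmf.prob (Pi_pmf (B (m div 2)) False D) {e. Q (m div 2) e}"
      using last_block by (intro mult_mono prod_nonneg) auto
    thus ?thesis
      by (simp add: lessThan_Suc_atMost[symmetric])
  qed
  ultimately show ?thesis by linarith
qed

section \<open>Asymptotics\<close>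

lemma minimax_risk_ge_exp:
  assumes "n \<ge> 4" "0 \<le> q" "q \<le> p" "0 < p" "16 * real n * p\<^sup>2 \<le> 1" "param_space n m 2 \<alpha> \<noteq> {}"
  shows "minimax_risk n m 2 p q \<alpha> \<ge> 3 / 64 * exp (- 8 * (real n * real m * p\<^sup>2))"
  using minimax_risk_ge[OF assms(1) _ assms(6), of "exp (- 8 * (real n * real m * p\<^sup>2)) / 2" p q]
    prob_isolated_ge[OF _ assms(2-5)] by simp

text \<open>With \<open>\<lambda> = n m p\<^sup>2\<close> one has \<open>n p\<^sup>2 = \<lambda> / m\<close>, where \<open>\<lambda>\<close> is at most of order \<open>log n\<close> while \<open>m\<close>
  exceeds every multiple of \<open>n log n\<close>. This is the place where \<open>m\<close> has to be large: the union bound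
  for a column pair is useful only if \<open>n p\<^sup>2\<close> is small.\<close>
lemma eventually_edge_sparse:
  assumes reg: "two_community_regime c n2 p \<alpha>"
    and O: "(\<lambda>n. real n * real (n2 n) * (p n)\<^sup>2) \<in> O(\<lambda>n. ln (real n))"
  shows "\<forall>\<^sub>F n in sequentially. 16 * real n * (p n)\<^sup>2 \<le> 1"
proof -
  obtain C where C: "C > 0"
    and le: "\<forall>\<^sub>F n in sequentially. norm (real n * real (n2 n) * (p n)\<^sup>2) \<le> C * norm (ln (real n))"
    using O by (elim landau_o.bigE)
  have "\<forall>\<^sub>F n in sequentially. 16 * C \<le> real (n2 n) / (real n * ln (real n))"
    using reg by (auto simp: two_community_regime_def filterlim_at_top)
  with le show ?thesis
    using eventually_ge_at_top[of 2]
  proof eventually_elim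
    case (elim n)
    have ln: "ln (real n) > 0"
      using elim by simp
    have "16 * C * (real n * ln (real n)) \<le> real (n2 n)"
      using elim(2,3) ln by (simp add: field_simps)
    hence "(real n * (p n)\<^sup>2) * (16 * C * (real n * ln (real n))) \<le> (real n * (p n)\<^sup>2) * real (n2 n)"
      by (intro mult_left_mono) auto
    also have "\<dots> \<le> C * ln (real n)"
      using elim(1) ln by (simp add: mult_ac)
    finally have "(C * ln (real n)) * (16 * real n * (p n)\<^sup>2 * real n) \<le> (C * ln (real n)) * 1"
      by (simp add: algebra_simps)
    hence "16 * real n * (p n)\<^sup>2 * real n \<le> 1"
      using C ln by (subst (asm) mult_le_cancel_left_pos) auto
    moreover have "16 * real n * (p n)\<^sup>2 * 1 \<le> 16 * real n * (p n)\<^sup>2 * real n"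
      using elim(3) by (intro mult_left_mono) auto
    ultimately show ?case by simp
  qed
qed

lemma eventually_minimax_risk_ge:
  assumes reg: "two_community_regime c n2 p \<alpha>"
    and O: "(\<lambda>n. real n * real (n2 n) * (p n)\<^sup>2) \<in> O(\<lambda>n. ln (real n))"
  shows "\<forall>\<^sub>F n in sequentially. minimax_risk n (n2 n) 2 (p n) (c * p n) (\<alpha> n) \<ge>
           3 / 64 * exp (- 8 * (real n * real (n2 n) * (p n)\<^sup>2))"
proof -
  have "\<forall>\<^sub>F n in sequentially. param_space n (n2 n) 2 (\<alpha> n) \<noteq> {}"
    using reg by (simp add: two_community_regime_def)
  thus ?thesis
    using eventually_edge_sparse[OF assms] eventually_ge_at_top[of 4]
  proof eventually_elim
    case (elim n)
    have "0 < c" "c < 1" "0 < p n"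
      using reg by (auto simp: two_community_regime_def)
    thus ?case
      using elim by (intro minimax_risk_ge_exp) (auto simp: mult_left_le_one_le)
  qed
qed

theorem theorem3:
  shows
    "(\<exists>c1>0. \<forall>(c::real) (n2 :: nat \<Rightarrow> nat) (p :: nat \<Rightarrow> real) (\<alpha> :: nat \<Rightarrow> real).
       two_community_regime c n2 p \<alpha> \<longrightarrow>
       filterlim (\<lambda>n. real n * real (n2 n) * (p n)\<^sup>2) at_top sequentially \<longrightarrow>
       (\<lambda>n. real n * real (n2 n) * (p n)\<^sup>2) \<in> O(\<lambda>n. ln (real n)) \<longrightarrow>
       (\<forall>\<^sub>F n in sequentially.
          minimax_risk n (n2 n) 2 (p n) (c * p n) (\<alpha> n)
            \<ge> exp (- c1 * (real n * real (n2 n) * (p n)\<^sup>2)))) \<and>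
     (\<forall>(c::real) (n2 :: nat \<Rightarrow> nat) (p :: nat \<Rightarrow> real) (\<alpha> :: nat \<Rightarrow> real).
       two_community_regime c n2 p \<alpha> \<longrightarrow>
       (\<lambda>n. real n * real (n2 n) * (p n)\<^sup>2) \<in> \<Theta>(\<lambda>_. 1) \<longrightarrow>
       (\<exists>c2>0. \<forall>\<^sub>F n in sequentially.
          minimax_risk n (n2 n) 2 (p n) (c * p n) (\<alpha> n) \<ge> c2))"
proof ((rule conjI, rule exI[of _ 9], rule conjI); (intro allI impI)?)
  fix c :: real and n2 :: "nat \<Rightarrow> nat" and p \<alpha> :: "nat \<Rightarrow> real"
  assume reg: "two_community_regime c n2 p \<alpha>"
    and lim: "filterlim (\<lambda>n. real n * real (n2 n) * (p n)\<^sup>2) at_top sequentially"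
    and O: "(\<lambda>n. real n * real (n2 n) * (p n)\<^sup>2) \<in> O(\<lambda>n. ln (real n))"
  have "\<forall>\<^sub>F n in sequentially. real n * real (n2 n) * (p n)\<^sup>2 \<ge> 22"
    using lim by (simp add: filterlim_at_top)
  thus "\<forall>\<^sub>F n in sequentially. minimax_risk n (n2 n) 2 (p n) (c * p n) (\<alpha> n)
            \<ge> exp (- 9 * (real n * real (n2 n) * (p n)\<^sup>2))"
    using eventually_minimax_risk_ge[OF reg O]
  proof eventually_elim
    case (elim n)
    define l where "l = real n * real (n2 n) * (p n)\<^sup>2"
    \<comment> \<open>One more factor \<open>exp (- l)\<close> absorbs the constant \<open>3 / 64\<close>; this is why the exponent is 9, not 8.\<close>
    have "64 / 3 \<le> exp l"
      using elim(1) exp_ge_add_one_self[of l] unfolding l_def by linarith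
    hence "exp (- 9 * l) * (64 / 3) \<le> exp (- 9 * l) * exp l"
      by (intro mult_left_mono) auto
    also have "\<dots> = exp (- 8 * l)"
      by (simp add: exp_add[symmetric])
    finally show ?case
      using elim(2) unfolding l_def by simp
  qed
next
  fix c :: real and n2 :: "nat \<Rightarrow> nat" and p \<alpha> :: "nat \<Rightarrow> real"
  let ?l = "\<lambda>n. real n * real (n2 n) * (p n)\<^sup>2"
  assume reg: "two_community_regime c n2 p \<alpha>" and \<Theta>: "?l \<in> \<Theta>(\<lambda>_. 1)"
  have O1: "?l \<in> O(\<lambda>_. 1)"
    using \<Theta> by blast
  have "(\<lambda>_. 1 :: real) \<in> O(\<lambda>n. ln (real n))"
  proof (rule landau_o.bigI[of 1])
    show "\<forall>\<^sub>F n in sequentially. norm (1 :: real) \<le> 1 * norm (ln (real n))"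
      using eventually_ge_at_top[of 3]
    proof eventually_elim
      case (elim n)
      have "exp 1 \<le> real n"
        using exp_le elim by linarith
      hence "1 \<le> ln (real n)"
        using elim by (subst ln_ge_iff) auto
      thus ?case by simp
    qed
  qed simp
  with O1 have O: "?l \<in> O(\<lambda>n. ln (real n))"
    by (rule landau_o.big_trans)
  obtain C where "C > 0" "\<forall>\<^sub>F n in sequentially. norm (?l n) \<le> C * norm (1 :: real)"
    using O1 by (elim landau_o.bigE)
  hence "\<forall>\<^sub>F n in sequentially. ?l n \<le> C"
    by (auto elim!: eventually_mono)
  hence "\<forall>\<^sub>F n in sequentially. minimax_risk n (n2 n) 2 (p n) (c * p n) (\<alpha> n)
            \<ge> 3 / 64 * exp (- 8 * C)"
    using eventually_minimax_risk_ge[OF reg O]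
  proof eventually_elim
    case (elim n)
    hence "exp (- 8 * C) \<le> exp (- 8 * ?l n)"
      by simp
    with elim(2) show ?case by linarith
  qed
  thus "\<exists>c2>0. \<forall>\<^sub>F n in sequentially. minimax_risk n (n2 n) 2 (p n) (c * p n) (\<alpha> n) \<ge> c2"
    by (intro exI[of _ "3 / 64 * exp (- 8 * C)"]) auto
qed simp

end
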